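(* Let $p \in (0,1)\setminus\{\tfrac12\}$. If $\mu$ and $\nu$ are two (Borel) probability measures on $[0,1]$ such that $\mu(\{0\})=\nu(\{0\})=0$, and the residual allocation models from $\mu$ and from $\nu$ have identical Bernoulli($p$) convolutions (i.e. the two convolutions, for this given $p$, have the same law), then $\mu=\nu$.
   Context: Residual allocation: given a Borel probability measure $\mu$ on $[0,1]$ with $\mu(\{0\})<1$, let $(Y_i)_{i\ge1}$ be i.i.d. random variables with law $\mu$ and set $X_1=Y_1$ and $X_i=Y_i\prod_{j=1}^{i-1}(1-Y_j)$ for $i\ge2$. Then almost surely $X_i\ge0$ and $\sum_{i\ge1}X_i=1$; the sequence $(X_i)_{i\ge1}$ is called the residual allocation model from $\mu$. Bernoulli($p$) convolution: let $(\varepsilon_i)_{i\ge1}$ be i.i.d. Bernoulli($p$) random variables (values in $\{0,1\}$, $P(\varepsilon_i=1)=p$), independent of $(X_i)_{i\ge1}$. The Bernoulli($p$) convolution of the residual allocation model from $\mu$ is the law of $Z=\sum_{i\ge1}\varepsilon_iX_i$. *)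

theory Defs
  imports "HOL-Probability.Probability"
begin

text \<open>
  Sequences are indexed from 0, so \<open>Y i\<close> and \<open>residual_allocation Y i\<close> stand for
  \<open>Y\<^sub>i\<^sub>+\<^sub>1\<close> and \<open>X\<^sub>i\<^sub>+\<^sub>1\<close>; the empty product gives \<open>X\<^sub>1 = Y\<^sub>1\<close>.
\<close>

definition residual_allocation :: "(nat \<Rightarrow> real) \<Rightarrow> nat \<Rightarrow> real" where
  "residual_allocation Y i = Y i * (\<Prod>j<i. 1 - Y j)"

definition bernoulli_sum :: "(nat \<Rightarrow> real) \<Rightarrow> (nat \<Rightarrow> bool) \<Rightarrow> real" where
  "bernoulli_sum Y e = (\<Sum>i. of_bool (e i) * residual_allocation Y i)"

text \<open>
  The law of \<open>Z\<close>, taken on the product space that carries the i.i.d. sequence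
  \<open>Y\<close> with law \<open>\<mu>\<close> and, independently of it, the i.i.d. Bernoulli(\<open>p\<close>) sequence.
  If \<open>\<mu>\<close> lives on the unit interval, the series converges almost surely. By the lemma
  below, any other choice of the underlying probability space gives the same law.
\<close>

definition bernoulli_convolution :: "real \<Rightarrow> real measure \<Rightarrow> real measure" where
  "bernoulli_convolution p \<mu> =
     distr ((\<Pi>\<^sub>M i\<in>(UNIV :: nat set). \<mu>) \<Otimes>\<^sub>M
            (\<Pi>\<^sub>M i\<in>(UNIV :: nat set). measure_pmf (bernoulli_pmf p)))
       borel (\<lambda>(Y, e). bernoulli_sum Y e)"

text \<open>
  Independence of the two sequences is stated as the joint law being the product of the
  laws, since \<open>indep_var\<close> requires both random elements to have the same range type.
\<close>

lemma (in prob_space) distr_bernoulli_sum: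
  fixes Y :: "nat \<Rightarrow> 'a \<Rightarrow> real" and e :: "nat \<Rightarrow> 'a \<Rightarrow> bool"
  assumes Y: "indep_vars (\<lambda>_. borel) Y UNIV" "\<And>i. distr M borel (Y i) = \<mu>"
    and e: "indep_vars (\<lambda>_. count_space UNIV) e UNIV"
      "\<And>i. distr M (count_space UNIV) (e i) = measure_pmf (bernoulli_pmf p)"
    and ind: "distr M ((\<Pi>\<^sub>M i\<in>UNIV. borel) \<Otimes>\<^sub>M (\<Pi>\<^sub>M i\<in>UNIV. count_space UNIV))
                (\<lambda>\<omega>. (\<lambda>i. Y i \<omega>, \<lambda>i. e i \<omega>)) =
              distr M (\<Pi>\<^sub>M i\<in>UNIV. borel) (\<lambda>\<omega> i. Y i \<omega>) \<Otimes>\<^sub>M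
              distr M (\<Pi>\<^sub>M i\<in>UNIV. count_space UNIV) (\<lambda>\<omega> i. e i \<omega>)"
  shows "distr M borel (\<lambda>\<omega>. bernoulli_sum (\<lambda>i. Y i \<omega>) (\<lambda>i. e i \<omega>)) =
         bernoulli_convolution p \<mu>"
proof -
  let ?A = "\<Pi>\<^sub>M i\<in>(UNIV::nat set). (borel :: real measure)"
  let ?B = "\<Pi>\<^sub>M i\<in>(UNIV::nat set). count_space (UNIV :: bool set)"
  have rv [measurable]: "Y i \<in> borel_measurable M" "e i \<in> measurable M (count_space UNIV)" for i
    using Y(1) e(1) unfolding indep_vars_def by auto
  have mY: "(\<lambda>\<omega> i. Y i \<omega>) \<in> measurable M ?A" and mE: "(\<lambda>\<omega> i. e i \<omega>) \<in> measurable M ?B"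
    by (auto intro!: measurable_PiM_single' rv)
  have "distr M ?A (\<lambda>\<omega> i. Y i \<omega>) = (\<Pi>\<^sub>M i\<in>(UNIV::nat set). \<mu>)"
    using indep_vars_iff_distr_eq_PiM[of UNIV Y "\<lambda>_. borel"] rv Y by (simp add: restrict_def)
  moreover have "distr M ?B (\<lambda>\<omega> i. e i \<omega>) = (\<Pi>\<^sub>M i\<in>(UNIV::nat set). measure_pmf (bernoulli_pmf p))"
    using indep_vars_iff_distr_eq_PiM[of UNIV e "\<lambda>_. count_space UNIV"] rv e
    by (simp add: restrict_def)
  ultimately have joint: "distr M (?A \<Otimes>\<^sub>M ?B) (\<lambda>\<omega>. (\<lambda>i. Y i \<omega>, \<lambda>i. e i \<omega>)) =
      (\<Pi>\<^sub>M i\<in>(UNIV::nat set). \<mu>) \<Otimes>\<^sub>M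
      (\<Pi>\<^sub>M i\<in>(UNIV::nat set). measure_pmf (bernoulli_pmf p))"
    using ind by simp
  have [measurable]: "(\<lambda>(Y, e). bernoulli_sum Y e) \<in> borel_measurable (?A \<Otimes>\<^sub>M ?B)"
    unfolding bernoulli_sum_def residual_allocation_def by measurable
  show ?thesis
    unfolding bernoulli_convolution_def joint[symmetric]
    by (subst distr_distr) (auto intro!: measurable_Pair mY mE simp: o_def)
qed

end

theory Submission imports Defs begin

text \<open>
  Let \<open>Y\<close> have law \<open>\<mu>\<close>, let \<open>Z\<close> have the Bernoulli(\<open>p\<close>) convolution of the model from \<open>\<mu>\<close>
  as its law, and put \<open>q = 1 - p\<close>. Splitting off the first piece shows that \<open>Z\<close> has the law of
  \<open>\<epsilon> Y + (1 - Y) Z'\<close> with \<open>Z'\<close> a copy of \<open>Z\<close> and \<open>\<epsilon>\<close>, \<open>Y\<close>, \<open>Z'\<close> independent. Therefore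
  \<open>E Z\<^sup>n = p E (Y + (1 - Y) Z')\<^sup>n + q E (1 - Y)\<^sup>n E Z\<^sup>n\<close>. Expanded in powers of \<open>Y\<close>, where
  \<open>Y + (1 - Y) Z' = Z' + Y (1 - Z')\<close>, this is for each \<open>n\<close> a homogeneous linear equation
  between the moments \<open>E Y, \<dots>, E Y\<^sup>n\<close> whose coefficients depend only on \<open>p\<close> and the law of \<open>Z\<close>
  (\<open>moments_linear_system\<close>). The coefficient of \<open>E Y\<^sup>n\<close> is
  \<open>p E (1 - Z)\<^sup>n + (-1)\<^sup>n q E Z\<^sup>n\<close>. If it is nonzero for all \<open>n \<ge> 2\<close>, the law of \<open>Z\<close>
  determines the moments of \<open>Y\<close> up to a common factor. That factor is a genuine ambiguity:
  mixing \<open>\<mu>\<close> with a point mass at 0 scales the moments and does not change \<open>Z\<close>. Two laws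
  without an atom at 0 and with proportional moments have the same size-biased law, hence
  agree (\<open>size_biased_inject\<close>).

  The heart of the matter is that the coefficient does not vanish (\<open>top_coeff_nonzero\<close>). For
  even \<open>n\<close> both terms are nonnegative and one is positive. For odd \<open>n\<close>, expand the same
  identity in powers of \<open>Z'\<close>: the moments of \<open>Z\<close> satisfy
  \<open>(\<Sum>k<n. w n k) E Z\<^sup>n = p (\<Sum>k<n. w n k E Z\<^sup>k)\<close> with nonnegative weights \<open>w n k\<close> that do not
  involve \<open>p\<close>, and those of \<open>1 - Z\<close> satisfy the same recursion with \<open>q\<close> in place of \<open>p\<close>. If
  \<open>p < q\<close>, an induction gives \<open>q E Z\<^sup>n \<le> p E (1 - Z)\<^sup>n\<close>, strictly for \<open>n \<ge> 2\<close> as soon as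
  \<open>w n 1 > 0\<close> (\<open>recursion_comparison\<close>); if \<open>q < p\<close>, exchange \<open>Z\<close> and \<open>1 - Z\<close>. Behind this is
  the formula \<open>E Z\<^sup>n = E p\<^sup>K\<close>, where \<open>K\<close> is the number of different pieces hit by \<open>n\<close> uniform
  points. The weight \<open>w n 1\<close> vanishes only if \<open>Y\<close> takes no values other than 0 and 1, and if
  that is the case for both laws, their moments are trivially proportional.
\<close>

section \<open>Distributions on the unit interval and their moments\<close>

definition mixed_moment :: "real measure \<Rightarrow> nat \<Rightarrow> nat \<Rightarrow> real" where
  "mixed_moment M i j = (\<integral>x. x ^ i * (1 - x) ^ j \<partial>M)"

locale unit_interval_distribution = real_distribution M for M :: "real measure" +
  assumes AE_unit: "AE x in M. x \<in> {0..1}"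
begin

lemma integrable_if_bounded_on_unit:
  fixes f :: "real \<Rightarrow> real"
  assumes "f \<in> borel_measurable borel" "\<And>x. x \<in> {0..1} \<Longrightarrow> \<bar>f x\<bar> \<le> B"
  shows "integrable M f"
proof (rule integrable_const_bound)
  show "AE x in M. norm (f x) \<le> B"
    using AE_unit by (rule eventually_mono) (simp add: assms(2))
qed (use assms(1) in simp)

lemma integral_nonneg_on_unit:
  fixes f :: "real \<Rightarrow> real"
  assumes "\<And>x. x \<in> {0..1} \<Longrightarrow> 0 \<le> f x"
  shows "0 \<le> integral\<^sup>L M f"
  by (intro integral_nonneg_AE eventually_mono[OF AE_unit] assms)

lemma expectation_diff_le:
  fixes f g :: "real \<Rightarrow> real"
  assumes int: "integrable M f" "integrable M g"
    and close: "\<And>x. x \<in> {0..1} \<Longrightarrow> \<bar>f x - g x\<bar> \<le> e"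
  shows "\<bar>integral\<^sup>L M f - integral\<^sup>L M g\<bar> \<le> e"
proof -
  have "\<bar>\<integral>x. f x - g x \<partial>M\<bar> \<le> (\<integral>x. \<bar>f x - g x\<bar> \<partial>M)"
    by (rule integral_abs_bound)
  also have "\<dots> \<le> e"
    using int by (intro integral_le_const eventually_mono[OF AE_unit] close) auto
  finally show ?thesis
    using int by simp
qed

lemma integrable_mixed [intro, simp]: "integrable M (\<lambda>x. x ^ i * (1 - x) ^ j)"
proof (rule integrable_if_bounded_on_unit[where B = 1])
  fix x :: real assume "x \<in> {0..1}"
  then show "\<bar>x ^ i * (1 - x) ^ j\<bar> \<le> 1"
    by (simp add: abs_mult power_abs mult_le_one power_le_one)
qed simp

lemma integrable_power_unit [intro, simp]: "integrable M (\<lambda>x. x ^ i)" "integrable M (\<lambda>x. (1 - x) ^ i)"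
  using integrable_mixed[of i 0] integrable_mixed[of 0 i] by simp_all

lemma mixed_moment_nonneg: "0 \<le> mixed_moment M i j"
  unfolding mixed_moment_def by (rule integral_nonneg_on_unit) auto

lemma mixed_moment_0_0 [simp]: "mixed_moment M 0 0 = 1"
  by (simp add: mixed_moment_def prob_space del: space_eq_univ)

lemma mixed_moment_eq_0_iff:
  "mixed_moment M i j = 0 \<longleftrightarrow> (AE x in M. x ^ i * (1 - x) ^ j = 0)"
  unfolding mixed_moment_def
  by (intro integral_nonneg_eq_0_iff_AE integrable_mixed eventually_mono[OF AE_unit]) simp

lemma binomial_expectation:
  "(\<integral>x. (\<Sum>k\<le>n. of_nat (n choose k) * x ^ (n - k) * (1 - x) ^ k * c k) \<partial>M) =
   (\<Sum>k\<le>n. of_nat (n choose k) * mixed_moment M (n - k) k * c k)"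
proof -
  let ?f = "\<lambda>k x. of_nat (n choose k) * x ^ (n - k) * (1 - x) ^ k * c k"
  have "integrable M (?f k)" for k
    using integrable_mult_right[OF integrable_mixed[of "n - k" k], of "of_nat (n choose k) * c k"]
    by (simp add: mult_ac)
  then have "(\<integral>x. (\<Sum>k\<le>n. ?f k x) \<partial>M) = (\<Sum>k\<le>n. integral\<^sup>L M (?f k))"
    by (rule Bochner_Integration.integral_sum)
  also have "\<dots> = (\<Sum>k\<le>n. of_nat (n choose k) * mixed_moment M (n - k) k * c k)"
  proof (rule sum.cong[OF refl])
    show "integral\<^sup>L M (?f k) = of_nat (n choose k) * mixed_moment M (n - k) k * c k" for k
      unfolding mixed_moment_def
      using integral_mult_right_zero[of M "of_nat (n choose k) * c k" "\<lambda>x. x ^ (n - k) * (1 - x) ^ k"]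
      by (simp add: mult_ac)
  qed
  finally show ?thesis .
qed

end

text \<open>
  By Weierstrass approximation equal moments give equal integrals of all continuous functions;
  applied to \<open>cos (t x)\<close> and \<open>sin (t x)\<close> this makes the characteristic functions equal.
\<close>

lemma unit_interval_distribution_eqI_moments:
  assumes "unit_interval_distribution M" "unit_interval_distribution N"
    and mom: "\<And>n. (\<integral>x. x ^ n \<partial>M) = (\<integral>x. x ^ n \<partial>N)"
  shows "M = N"
proof -
  interpret M: unit_interval_distribution M by fact
  interpret N: unit_interval_distribution N by fact
  have cont: "integral\<^sup>L M f = integral\<^sup>L N f" if f: "continuous_on UNIV f" for f :: "real \<Rightarrow> real"
  proof -
    have fm [measurable]: "f \<in> borel_measurable borel"
      using f by (rule borel_measurable_continuous_onI)
    have "bounded (f ` {0..1})"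
      using f by (intro compact_imp_bounded compact_continuous_image) (auto intro: continuous_on_subset)
    then have "\<exists>B. \<forall>x\<in>{0..1}. \<bar>f x\<bar> \<le> B"
      unfolding bounded_iff by simp
    then obtain B where B: "\<And>x. x \<in> {0..1} \<Longrightarrow> \<bar>f x\<bar> \<le> B"
      by blast
    have fi: "integrable M f" "integrable N f"
      by (auto intro!: M.integrable_if_bounded_on_unit[where B = B] N.integrable_if_bounded_on_unit[where B = B] B)
    have "\<bar>integral\<^sup>L M f - integral\<^sup>L N f\<bar> \<le> 0"
    proof (rule field_le_epsilon)
      fix e :: real assume "0 < e"
      then obtain g where g: "real_polynomial_function g" "\<And>x. x \<in> {0..1} \<Longrightarrow> \<bar>f x - g x\<bar> < e / 2"
        using Stone_Weierstrass_real_polynomial_function[of "{0..1::real}" f "e / 2"] f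
        by (metis compact_Icc continuous_on_subset half_gt_zero_iff top_greatest)
      then obtain a n where ga: "g = (\<lambda>x. \<Sum>i\<le>n. a i * x ^ i)"
        unfolding real_polynomial_function_iff_sum by blast
      have gi: "integrable M g" "integrable N g"
        unfolding ga by auto
      have eq: "integral\<^sup>L M g = integral\<^sup>L N g"
        unfolding ga by (simp add: mom)
      show "\<bar>integral\<^sup>L M f - integral\<^sup>L N f\<bar> \<le> 0 + e"
      proof -
        have "\<bar>integral\<^sup>L M f - integral\<^sup>L M g\<bar> \<le> e / 2" "\<bar>integral\<^sup>L N f - integral\<^sup>L N g\<bar> \<le> e / 2"
          using fi gi g(2) less_imp_le by (blast intro: M.expectation_diff_le N.expectation_diff_le)+
        with eq show ?thesis by linarith
      qed
    qed
    then show ?thesis by simp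
  qed
  have "char M t = char N t" for t
  proof (rule complex_eqI)
    have int: "integrable M (\<lambda>x. iexp (t * x))" "integrable N (\<lambda>x. iexp (t * x))"
      by (auto intro!: M.integrable_iexp N.integrable_iexp)
    show "Re (char M t) = Re (char N t)"
      unfolding char_def using int cont[of "\<lambda>x. cos (t * x)"]
      by (simp flip: integral_Re add: Re_exp continuous_intros)
    show "Im (char M t) = Im (char N t)"
      unfolding char_def using int cont[of "\<lambda>x. sin (t * x)"]
      by (simp flip: integral_Im add: Im_exp continuous_intros)
  qed
  then show ?thesis
    by (intro Levy_uniqueness) (auto intro: M.real_distribution_axioms N.real_distribution_axioms)
qed

section \<open>Splitting off the first piece\<close>

lemma residual_allocation_case_nat:
  "residual_allocation (case_nat y Y) i =
     (case i of 0 \<Rightarrow> y | Suc i \<Rightarrow> (1 - y) * residual_allocation Y i)"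
  by (cases i) (simp_all add: residual_allocation_def prod.lessThan_Suc_shift del: prod.lessThan_Suc)

lemma sum_residual_allocation: "(\<Sum>i<n. residual_allocation Y i) = 1 - (\<Prod>i<n. 1 - Y i)"
  by (induction n) (auto simp: residual_allocation_def algebra_simps)

context
  fixes Y :: "nat \<Rightarrow> real"
  assumes Y: "\<And>i. Y i \<in> {0..1}"
begin

lemma residual_allocation_nonneg: "0 \<le> residual_allocation Y i"
  using Y unfolding residual_allocation_def by (auto intro!: mult_nonneg_nonneg prod_nonneg)

lemma sum_of_bool_residual_allocation_le_1:
  "(\<Sum>i<n. of_bool (e i) * residual_allocation Y i) \<le> 1"
proof -
  have "(\<Sum>i<n. of_bool (e i) * residual_allocation Y i) \<le> (\<Sum>i<n. residual_allocation Y i)"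
    by (intro sum_mono) (auto simp: residual_allocation_nonneg)
  also have "\<dots> \<le> 1"
    using Y by (auto simp: sum_residual_allocation intro!: prod_nonneg)
  finally show ?thesis .
qed

lemma summable_bernoulli_sum: "summable (\<lambda>i. of_bool (e i) * residual_allocation Y i)"
  using sum_of_bool_residual_allocation_le_1
  by (intro summableI_nonneg_bounded[where x = 1]) (auto simp: residual_allocation_nonneg)

lemma bernoulli_sum_in_unit: "bernoulli_sum Y e \<in> {0..1}"
  unfolding bernoulli_sum_def atLeastAtMost_iff
  using summable_bernoulli_sum sum_of_bool_residual_allocation_le_1
  by (auto intro!: suminf_nonneg suminf_le_const simp: residual_allocation_nonneg)

lemma bernoulli_sum_case_nat:
  "bernoulli_sum (case_nat y Y) (case_nat b e) = of_bool b * y + (1 - y) * bernoulli_sum Y e"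
proof -
  have "(\<lambda>i. of_bool (e i) * residual_allocation Y i) sums bernoulli_sum Y e"
    unfolding bernoulli_sum_def by (rule summable_sums summable_bernoulli_sum)+
  then have "(\<lambda>i. (1 - y) * (of_bool (e i) * residual_allocation Y i)) sums ((1 - y) * bernoulli_sum Y e)"
    by (rule sums_mult)
  then have "(\<lambda>i. of_bool (case_nat b e (Suc i)) * residual_allocation (case_nat y Y) (Suc i))
      sums ((1 - y) * bernoulli_sum Y e)"
    by (simp add: residual_allocation_case_nat ac_simps)
  from sums_Suc[OF this] show ?thesis
    unfolding bernoulli_sum_def by (simp add: sums_iff residual_allocation_case_nat)
qed

end

context
  fixes p :: real and \<mu> :: "real measure"
  assumes p: "0 < p" "p < 1" and \<mu>: "unit_interval_distribution \<mu>"
begin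

interpretation \<mu>: unit_interval_distribution \<mu> by (rule \<mu>)
interpretation Y: sequence_space \<mu> ..
interpretation B: sequence_space "measure_pmf (bernoulli_pmf p)" ..

lemma borel_measurable_bernoulli_sum [measurable]:
  "(\<lambda>(Y, e). bernoulli_sum Y e) \<in> borel_measurable (Y.S \<Otimes>\<^sub>M B.S)"
  unfolding bernoulli_sum_def residual_allocation_def by measurable

lemma AE_in_unit_interval: "AE Y in Y.S. \<forall>i. Y i \<in> {0..1}"
  unfolding AE_all_countable
  by (intro allI AE_PiM_component \<mu>.AE_unit) (auto intro: \<mu>.prob_space_axioms)

lemma unit_interval_distribution_bernoulli_convolution:
  "unit_interval_distribution (bernoulli_convolution p \<mu>)"
proof -
  interpret YB: pair_prob_space Y.S B.S ..
  have "AE z in bernoulli_convolution p \<mu>. z \<in> {0..1}"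
  proof -
    have "AE Y in Y.S. AE e in B.S. (\<lambda>(Y, e). bernoulli_sum Y e) (Y, e) \<in> {0..1}"
      using AE_in_unit_interval
      by (rule eventually_mono) (use bernoulli_sum_in_unit in \<open>simp del: atLeastAtMost_iff\<close>)
    then have "AE x in Y.S \<Otimes>\<^sub>M B.S. (\<lambda>(Y, e). bernoulli_sum Y e) x \<in> {0..1}"
      by (rule YB.AE_pair_measure[rotated]) measurable
    then show ?thesis
      unfolding bernoulli_convolution_def
      by (subst AE_distr_iff) (simp_all del: atLeastAtMost_iff)
  qed
  moreover have "prob_space (bernoulli_convolution p \<mu>)"
    unfolding bernoulli_convolution_def by (rule YB.prob_space_distr) simp
  moreover have "sets (bernoulli_convolution p \<mu>) = sets borel"
    by (simp add: bernoulli_convolution_def)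
  ultimately show ?thesis
    by (intro unit_interval_distribution.intro real_distribution.intro
        real_distribution_axioms.intro unit_interval_distribution_axioms.intro)
qed

text \<open>
  After the first piece, of size \<open>y\<close>, the rest of the stick is a copy of the whole model
  shrunk by the factor \<open>1 - y\<close>. Hence \<open>Z\<close> has the law of \<open>\<epsilon> Y + (1 - Y) Z'\<close>, where \<open>\<epsilon>\<close>, \<open>Y\<close>
  and the copy \<open>Z'\<close> of \<open>Z\<close> are independent. The two summands are the cases \<open>\<epsilon> = 1\<close> and \<open>\<epsilon> = 0\<close>.
\<close>

lemma nn_integral_bernoulli_convolution_first_piece:
  fixes h :: "real \<Rightarrow> ennreal"
  assumes h [measurable]: "h \<in> borel_measurable borel"
  shows "(\<integral>\<^sup>+z. h z \<partial>bernoulli_convolution p \<mu>) =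
    (\<integral>\<^sup>+y. ennreal p * (\<integral>\<^sup>+z. h (y + (1 - y) * z) \<partial>bernoulli_convolution p \<mu>) +
         ennreal (1 - p) * (\<integral>\<^sup>+z. h ((1 - y) * z) \<partial>bernoulli_convolution p \<mu>) \<partial>\<mu>)"
proof -
  have L: "(\<integral>\<^sup>+z. g z \<partial>bernoulli_convolution p \<mu>) = (\<integral>\<^sup>+Y. \<integral>\<^sup>+e. g (bernoulli_sum Y e) \<partial>B.S \<partial>Y.S)"
    if [measurable]: "g \<in> borel_measurable borel" for g :: "real \<Rightarrow> ennreal"
    unfolding bernoulli_convolution_def
    by (simp add: nn_integral_distr B.nn_integral_fst[symmetric] case_prod_beta)
  \<comment> \<open>The expectation of \<open>h Z\<close> given all the proportions. The first Bernoulli variable is split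
    off inside \<open>F\<close>, the first proportion afterwards.\<close>
  define F where "F Y = (\<integral>\<^sup>+e. h (bernoulli_sum Y e) \<partial>B.S)" for Y
  have F [measurable]: "F \<in> borel_measurable Y.S"
    unfolding F_def by measurable
  have F_step: "F (case_nat y Y) =
      ennreal p * (\<integral>\<^sup>+e. h (y + (1 - y) * bernoulli_sum Y e) \<partial>B.S) +
      ennreal (1 - p) * (\<integral>\<^sup>+e. h ((1 - y) * bernoulli_sum Y e) \<partial>B.S)"
    if "\<forall>i. Y i \<in> {0..1}" and [measurable]: "Y \<in> space Y.S" and [measurable]: "y \<in> space \<mu>" for y Y
  proof -
    have [measurable]: "(\<lambda>e. bernoulli_sum (case_nat y Y) e) \<in> borel_measurable B.S"
      by measurable
    have "F (case_nat y Y) = (\<integral>\<^sup>+e. h (bernoulli_sum (case_nat y Y) e)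
        \<partial>distr (measure_pmf (bernoulli_pmf p) \<Otimes>\<^sub>M B.S) B.S (\<lambda>(b, e). case_nat b e))"
      by (simp add: F_def B.PiM_iter)
    also have "\<dots> = (\<integral>\<^sup>+(b, e). h (bernoulli_sum (case_nat y Y) (case_nat b e))
        \<partial>(measure_pmf (bernoulli_pmf p) \<Otimes>\<^sub>M B.S))"
      by (subst nn_integral_distr) (auto simp: case_prod_unfold)
    also have "\<dots> = (\<integral>\<^sup>+b. \<integral>\<^sup>+e. h (bernoulli_sum (case_nat y Y) (case_nat b e))
        \<partial>B.S \<partial>measure_pmf (bernoulli_pmf p))"
      by (subst B.nn_integral_fst[symmetric]) auto
    also have "\<dots> = (\<integral>\<^sup>+b. \<integral>\<^sup>+e. h (of_bool b * y + (1 - y) * bernoulli_sum Y e)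
        \<partial>B.S \<partial>measure_pmf (bernoulli_pmf p))"
      using that(1) by (simp only: bernoulli_sum_case_nat)
    finally show ?thesis
      using p by (simp add: mult.commute)
  qed
  have "(\<integral>\<^sup>+z. h z \<partial>bernoulli_convolution p \<mu>) = (\<integral>\<^sup>+Y. F Y \<partial>Y.S)"
    by (simp add: L F_def)
  also have "\<dots> = (\<integral>\<^sup>+Y. F Y \<partial>distr (\<mu> \<Otimes>\<^sub>M Y.S) Y.S (\<lambda>(y, Y). case_nat y Y))"
    by (simp only: Y.PiM_iter)
  also have "\<dots> = (\<integral>\<^sup>+(y, Y). F (case_nat y Y) \<partial>(\<mu> \<Otimes>\<^sub>M Y.S))"
    by (subst nn_integral_distr) (auto simp: case_prod_unfold)
  also have "\<dots> = (\<integral>\<^sup>+y. \<integral>\<^sup>+Y. F (case_nat y Y) \<partial>Y.S \<partial>\<mu>)"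
    by (subst Y.nn_integral_fst[symmetric]) auto
  also have "\<dots> = (\<integral>\<^sup>+y. \<integral>\<^sup>+Y.
      ennreal p * (\<integral>\<^sup>+e. h (y + (1 - y) * bernoulli_sum Y e) \<partial>B.S) +
      ennreal (1 - p) * (\<integral>\<^sup>+e. h ((1 - y) * bernoulli_sum Y e) \<partial>B.S) \<partial>Y.S \<partial>\<mu>)"
  proof (rule nn_integral_cong, rule nn_integral_cong_AE)
    show "AE Y in Y.S. F (case_nat y Y) =
        ennreal p * (\<integral>\<^sup>+e. h (y + (1 - y) * bernoulli_sum Y e) \<partial>B.S) +
        ennreal (1 - p) * (\<integral>\<^sup>+e. h ((1 - y) * bernoulli_sum Y e) \<partial>B.S)"
      if "y \<in> space \<mu>" for y
      using AE_in_unit_interval AE_space by eventually_elim (rule F_step[OF _ _ that])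
  qed
  also have "\<dots> = (\<integral>\<^sup>+y. ennreal p * (\<integral>\<^sup>+z. h (y + (1 - y) * z) \<partial>bernoulli_convolution p \<mu>) +
         ennreal (1 - p) * (\<integral>\<^sup>+z. h ((1 - y) * z) \<partial>bernoulli_convolution p \<mu>) \<partial>\<mu>)"
  proof (rule nn_integral_cong)
    fix y
    have [measurable]: "(\<lambda>Y. \<integral>\<^sup>+e. h (y + (1 - y) * bernoulli_sum Y e) \<partial>B.S) \<in> borel_measurable Y.S"
      "(\<lambda>Y. \<integral>\<^sup>+e. h ((1 - y) * bernoulli_sum Y e) \<partial>B.S) \<in> borel_measurable Y.S"
      by measurable
    show "(\<integral>\<^sup>+Y. ennreal p * (\<integral>\<^sup>+e. h (y + (1 - y) * bernoulli_sum Y e) \<partial>B.S) +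
          ennreal (1 - p) * (\<integral>\<^sup>+e. h ((1 - y) * bernoulli_sum Y e) \<partial>B.S) \<partial>Y.S) =
        ennreal p * (\<integral>\<^sup>+z. h (y + (1 - y) * z) \<partial>bernoulli_convolution p \<mu>) +
        ennreal (1 - p) * (\<integral>\<^sup>+z. h ((1 - y) * z) \<partial>bernoulli_convolution p \<mu>)"
      by (subst nn_integral_add) (simp_all add: nn_integral_cmult L)
  qed
  finally show ?thesis .
qed

end

section \<open>Moments under the distributional equation\<close>

text \<open>
  From here on only the distributional equation for \<open>Z\<close> matters: \<open>M\<close> is the law of the
  proportions and \<open>L\<close> any law on the unit interval that solves the equation.
\<close>

locale first_piece_equation =
  Y: unit_interval_distribution M + Z: unit_interval_distribution L
  for p :: real and M L :: "real measure" +
  assumes p: "0 < p" "p < 1"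
    and nonzero: "AE y in M. y \<noteq> 0"
    and first_piece: "h \<in> borel_measurable borel \<Longrightarrow> (\<integral>\<^sup>+z. h z \<partial>L) =
      (\<integral>\<^sup>+y. ennreal p * (\<integral>\<^sup>+z. h (y + (1 - y) * z) \<partial>L) +
            ennreal (1 - p) * (\<integral>\<^sup>+z. h ((1 - y) * z) \<partial>L) \<partial>M)"
begin

lemma expectation_first_piece:
  fixes h :: "real \<Rightarrow> real"
  assumes h [measurable]: "h \<in> borel_measurable borel" and h01: "\<And>x. x \<in> {0..1} \<Longrightarrow> h x \<in> {0..1}"
  shows "(\<integral>z. h z \<partial>L) =
    p * (\<integral>y. (\<integral>z. h (y + (1 - y) * z) \<partial>L) \<partial>M) + (1 - p) * (\<integral>y. (\<integral>z. h ((1 - y) * z) \<partial>L) \<partial>M)"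
proof -
  have nn: "(\<integral>\<^sup>+z. ennreal (g z) \<partial>L) = ennreal (\<integral>z. g z \<partial>L)" "0 \<le> (\<integral>z. g z \<partial>L)" "(\<integral>z. g z \<partial>L) \<le> 1"
    if [measurable]: "g \<in> borel_measurable borel" and g01: "\<And>x. x \<in> {0..1} \<Longrightarrow> g x \<in> {0..1}" for g :: "real \<Rightarrow> real"
  proof -
    have i: "integrable L g"
      using g01 by (intro Z.integrable_if_bounded_on_unit[where B = 1]) auto
    show "(\<integral>\<^sup>+z. ennreal (g z) \<partial>L) = ennreal (\<integral>z. g z \<partial>L)"
      using g01 by (intro nn_integral_eq_integral i eventually_mono[OF Z.AE_unit]) auto
    show "0 \<le> (\<integral>z. g z \<partial>L)"
      using g01 by (intro Z.integral_nonneg_on_unit) auto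
    show "(\<integral>z. g z \<partial>L) \<le> 1"
      using g01 by (intro Z.integral_le_const i eventually_mono[OF Z.AE_unit]) auto
  qed
  let ?G = "\<lambda>y. (\<integral>z. h (y + (1 - y) * z) \<partial>L)" and ?H = "\<lambda>y. (\<integral>z. h ((1 - y) * z) \<partial>L)"
  have mix: "(1 - y) * z \<in> {0..1}" "y + (1 - y) * z \<in> {0..1}" if "y \<in> {0..1}" "z \<in> {0..1}" for y z :: real
  proof -
    have "(1 - y) * z \<ge> 0" "(1 - y) * z \<le> (1 - y) * 1"
      using that by (auto simp del: mult_1_right intro!: mult_left_mono)
    then show "(1 - y) * z \<in> {0..1}" "y + (1 - y) * z \<in> {0..1}"
      using that by auto
  qed
  have GH: "?G y \<in> {0..1}" "?H y \<in> {0..1}"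
    "(\<integral>\<^sup>+z. ennreal (h (y + (1 - y) * z)) \<partial>L) = ennreal (?G y)"
    "(\<integral>\<^sup>+z. ennreal (h ((1 - y) * z)) \<partial>L) = ennreal (?H y)" if "y \<in> {0..1}" for y
    using nn[of "\<lambda>z. h (y + (1 - y) * z)"] nn[of "\<lambda>z. h ((1 - y) * z)"] mix that h01 by auto
  have meas: "?G \<in> borel_measurable borel" "?H \<in> borel_measurable borel"
    by measurable
  have abs: "\<bar>?G y\<bar> \<le> 1" "\<bar>?H y\<bar> \<le> 1" if "y \<in> {0..1}" for y
    using GH(1,2)[OF that] by (simp_all del: of_real_1)
  have int: "integrable M ?G" "integrable M ?H"
    by (rule Y.integrable_if_bounded_on_unit[OF meas(1) abs(1)] Y.integrable_if_bounded_on_unit[OF meas(2) abs(2)]; assumption)+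
  have "ennreal (\<integral>z. h z \<partial>L) = (\<integral>\<^sup>+z. ennreal (h z) \<partial>L)"
    using nn(1)[of h] h01 by simp
  also have "\<dots> = (\<integral>\<^sup>+y. ennreal (p * ?G y + (1 - p) * ?H y) \<partial>M)"
    unfolding first_piece[OF measurable_compose[OF h measurable_ennreal]]
  proof (intro nn_integral_cong_AE eventually_mono[OF Y.AE_unit])
    fix y :: real assume "y \<in> {0..1}"
    then show "ennreal p * (\<integral>\<^sup>+z. ennreal (h (y + (1 - y) * z)) \<partial>L) +
        ennreal (1 - p) * (\<integral>\<^sup>+z. ennreal (h ((1 - y) * z)) \<partial>L) = ennreal (p * ?G y + (1 - p) * ?H y)"
      using p GH[of y] by (simp add: ennreal_mult ennreal_plus)
  qed
  also have "\<dots> = ennreal (\<integral>y. p * ?G y + (1 - p) * ?H y \<partial>M)"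
    using p GH(1,2) int
    by (intro nn_integral_eq_integral eventually_mono[OF Y.AE_unit]) auto
  finally have "ennreal (\<integral>z. h z \<partial>L) = ennreal (\<integral>y. p * ?G y + (1 - p) * ?H y \<partial>M)" .
  moreover have "0 \<le> (\<integral>z. h z \<partial>L)"
    using nn(2)[of h] h01 by simp
  moreover have "0 \<le> (\<integral>y. p * ?G y + (1 - p) * ?H y \<partial>M)"
    using p GH(1,2) by (intro Y.integral_nonneg_on_unit) auto
  ultimately have "(\<integral>z. h z \<partial>L) = (\<integral>y. p * ?G y + (1 - p) * ?H y \<partial>M)"
    by simp
  then show ?thesis
    using int by simp
qed

text \<open>
  Two ways of expanding the same power. Read as a polynomial in the copy of \<open>Z\<close>, it yields
  recursions for the moments of \<open>L\<close> with nonnegative weights; \<open>u\<close> is \<open>Z\<close> or \<open>1 - Z\<close>. Read as a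
  polynomial in \<open>Y\<close>, it is linear in the moments of \<open>M\<close> with coefficients determined by \<open>L\<close>.
\<close>

lemma integral_binomial_left:
  fixes u :: "real \<Rightarrow> real"
  assumes u: "\<And>k. integrable L (\<lambda>z. u z ^ k)"
  shows "(\<integral>y. (\<integral>z. (y + (1 - y) * u z) ^ n \<partial>L) \<partial>M) =
     (\<Sum>k\<le>n. of_nat (n choose k) * mixed_moment M (n - k) k * (\<integral>z. u z ^ k \<partial>L))"
proof -
  have "(\<integral>z. (y + (1 - y) * u z) ^ n \<partial>L) =
      (\<Sum>k\<le>n. of_nat (n choose k) * y ^ (n - k) * (1 - y) ^ k * (\<integral>z. u z ^ k \<partial>L))" for y
  proof -
    have "(\<integral>z. (y + (1 - y) * u z) ^ n \<partial>L) =
        (\<integral>z. (\<Sum>k\<le>n. of_nat (n choose k) * y ^ (n - k) * (1 - y) ^ k * u z ^ k) \<partial>L)"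
      by (subst add.commute, subst binomial_ring) (simp add: power_mult_distrib mult_ac)
    then show ?thesis
      by (simp add: u)
  qed
  then show ?thesis
    by (simp add: Y.binomial_expectation)
qed

lemma integral_binomial_right:
  "(\<integral>y. (\<integral>z. (y + (1 - y) * z) ^ n \<partial>L) \<partial>M) =
     (\<Sum>k\<le>n. of_nat (n choose k) * mixed_moment M k 0 * mixed_moment L (n - k) k)"
proof -
  have "(\<integral>z. (y + (1 - y) * z) ^ n \<partial>L) =
      (\<Sum>k\<le>n. of_nat (n choose k) * mixed_moment L (n - k) k * y ^ k)" for y
  proof -
    have "(y + (1 - y) * z) ^ n = (\<Sum>k\<le>n. of_nat (n choose k) * z ^ (n - k) * (1 - z) ^ k * y ^ k)" for z
    proof -
      have "y + (1 - y) * z = y * (1 - z) + z"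
        by (simp add: algebra_simps)
      then show ?thesis
        by (simp add: binomial_ring power_mult_distrib mult_ac)
    qed
    then show ?thesis
      using Z.binomial_expectation[of n "\<lambda>k. y ^ k"] by simp
  qed
  then show ?thesis
    by (simp add: mixed_moment_def mult_ac)
qed

lemma integral_product_power:
  "(\<integral>y. (\<integral>z. ((1 - y) * z) ^ n \<partial>L) \<partial>M) = mixed_moment M 0 n * mixed_moment L n 0"
  "(\<integral>y. (\<integral>z. ((1 - y) * (1 - z)) ^ n \<partial>L) \<partial>M) = mixed_moment M 0 n * mixed_moment L 0 n"
  by (simp_all add: power_mult_distrib mixed_moment_def)

lemma moment_identity:
  "mixed_moment L n 0 =
     p * (\<integral>y. (\<integral>z. (y + (1 - y) * z) ^ n \<partial>L) \<partial>M) + (1 - p) * mixed_moment M 0 n * mixed_moment L n 0"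
  using expectation_first_piece[of "\<lambda>z. z ^ n"]
  by (simp add: power_le_one integral_product_power) (simp add: mixed_moment_def)

text \<open>
  Since \<open>1 - Z\<close> has the law of \<open>(1 - \<epsilon>) Y + (1 - Y) (1 - Z')\<close>, it satisfies the equation of
  \<open>Z\<close> with \<open>p\<close> and \<open>1 - p\<close> exchanged.
\<close>

lemma complement_moment_identity:
  "mixed_moment L 0 n =
     (1 - p) * (\<integral>y. (\<integral>z. (y + (1 - y) * (1 - z)) ^ n \<partial>L) \<partial>M) + p * mixed_moment M 0 n * mixed_moment L 0 n"
proof -
  have "1 - (y + (1 - y) * z) = (1 - y) * (1 - z)" "1 - (1 - y) * z = y + (1 - y) * (1 - z)" for y z :: real
    by (simp_all add: algebra_simps)
  then show ?thesis
    using expectation_first_piece[of "\<lambda>z. (1 - z) ^ n"]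
    by (simp add: power_le_one integral_product_power) (simp add: mixed_moment_def)
qed

text \<open>
  The probability that exactly \<open>n - k\<close> of \<open>n\<close> independent uniform points of the stick fall into
  the first piece.
\<close>

definition weight :: "nat \<Rightarrow> nat \<Rightarrow> real" where
  "weight n k = of_nat (n choose k) * mixed_moment M (n - k) k"

lemma weight_nonneg: "0 \<le> weight n k"
  by (simp add: weight_def Y.mixed_moment_nonneg)

lemma sum_weight: "(\<Sum>k<n. weight n k) = 1 - mixed_moment M 0 n"
proof -
  have "(\<Sum>k\<le>n. weight n k) = (\<integral>y. (\<Sum>k\<le>n. of_nat (n choose k) * y ^ (n - k) * (1 - y) ^ k) \<partial>M)"
    using Y.binomial_expectation[of n "\<lambda>_. 1"] by (simp add: weight_def)
  also have "\<dots> = (\<integral>y. ((1 - y) + y) ^ n \<partial>M)"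
    by (subst binomial_ring) (simp add: mult_ac)
  also have "\<dots> = 1"
    using Y.prob_space by (simp del: Y.space_eq_univ)
  finally show ?thesis
    by (simp add: weight_def lessThan_Suc_atMost[symmetric])
qed

text \<open>
  The moment of order \<open>n\<close> occurs on both sides of the identity above, on the right with total
  coefficient \<open>mixed_moment M 0 n\<close>. Collecting it on the left turns \<open>1 - mixed_moment M 0 n\<close>
  into the sum of the other weights.
\<close>

lemma moment_recursion:
  "(\<Sum>k<n. weight n k) * mixed_moment L n 0 = p * (\<Sum>k<n. weight n k * mixed_moment L k 0)"
proof -
  have "(\<integral>y. (\<integral>z. (y + (1 - y) * z) ^ n \<partial>L) \<partial>M) = (\<Sum>k\<le>n. weight n k * mixed_moment L k 0)"
    using integral_binomial_left[of "\<lambda>z. z" n] by (simp add: weight_def mixed_moment_def)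
  also have "\<dots> = (\<Sum>k<n. weight n k * mixed_moment L k 0) + mixed_moment M 0 n * mixed_moment L n 0"
    by (simp add: lessThan_Suc_atMost[symmetric] weight_def)
  finally show ?thesis
    using moment_identity[of n] unfolding sum_weight by (simp add: algebra_simps)
qed

lemma complement_moment_recursion:
  "(\<Sum>k<n. weight n k) * mixed_moment L 0 n = (1 - p) * (\<Sum>k<n. weight n k * mixed_moment L 0 k)"
proof -
  have "(\<integral>y. (\<integral>z. (y + (1 - y) * (1 - z)) ^ n \<partial>L) \<partial>M) = (\<Sum>k\<le>n. weight n k * mixed_moment L 0 k)"
    using integral_binomial_left[of "\<lambda>z. 1 - z" n] by (simp add: weight_def mixed_moment_def)
  also have "\<dots> = (\<Sum>k<n. weight n k * mixed_moment L 0 k) + mixed_moment M 0 n * mixed_moment L 0 n"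
    by (simp add: lessThan_Suc_atMost[symmetric] weight_def)
  finally show ?thesis
    using complement_moment_identity[of n] unfolding sum_weight by (simp add: algebra_simps)
qed

lemma weight_0_pos: assumes "1 \<le> n" shows "0 < weight n 0"
proof -
  have "mixed_moment M n 0 \<noteq> 0"
  proof
    assume "mixed_moment M n 0 = 0"
    then have "AE y in M. y ^ n = 0"
      by (simp add: Y.mixed_moment_eq_0_iff)
    with nonzero have "AE y in M. False"
      by eventually_elim simp
    then show False
      by simp
  qed
  then show ?thesis
    using Y.mixed_moment_nonneg[of n 0] by (simp add: weight_def)
qed

lemma weight_1_pos: assumes "2 \<le> n" "mixed_moment M 1 1 \<noteq> 0" shows "0 < weight n 1"
proof -
  have "mixed_moment M (n - 1) 1 \<noteq> 0"
  proof
    assume "mixed_moment M (n - 1) 1 = 0"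
    then have "AE y in M. y ^ (n - 1) * (1 - y) ^ 1 = 0"
      by (simp only: Y.mixed_moment_eq_0_iff)
    then have "AE y in M. y ^ 1 * (1 - y) ^ 1 = 0"
      by (rule eventually_mono) (use assms in auto)
    then have "mixed_moment M 1 1 = 0"
      by (simp only: Y.mixed_moment_eq_0_iff)
    with assms(2) show False ..
  qed
  then show ?thesis
    using Y.mixed_moment_nonneg[of "n - 1" 1] assms(1) by (simp add: weight_def)
qed

text \<open>
  The coefficient of the \<open>k\<close>-th moment of \<open>M\<close> in the moment identity of order \<open>n\<close>. It depends
  on \<open>p\<close> and \<open>L\<close> alone, so that two laws of proportions with the same convolution have the same
  coefficients.
\<close>

definition linear_coeff :: "nat \<Rightarrow> nat \<Rightarrow> real" where
  "linear_coeff n k = of_nat (n choose k) *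
     (p * mixed_moment L (n - k) k + (1 - p) * (-1) ^ k * mixed_moment L n 0)"

text \<open>
  The system is homogeneous because the term \<open>k = 0\<close> of the expansion equals the left-hand
  side of the moment identity.
\<close>

lemma moments_linear_system: "(\<Sum>k=1..n. linear_coeff n k * mixed_moment M k 0) = 0"
proof -
  have pow: "mixed_moment M 0 n = (\<Sum>k\<le>n. of_nat (n choose k) * (-1) ^ k * mixed_moment M k 0)"
  proof -
    have "(1 - y) ^ n = (\<Sum>k\<le>n. of_nat (n choose k) * (-1) ^ k * y ^ k)" for y :: real
      using binomial_ring[of "- y" 1 n] by (simp add: power_minus[of y] mult_ac)
    then show ?thesis
      by (simp add: mixed_moment_def)
  qed
  have "mixed_moment L n 0 = (\<Sum>k\<le>n. linear_coeff n k * mixed_moment M k 0)"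
    using moment_identity[of n] unfolding integral_binomial_right pow
    by (simp add: linear_coeff_def sum_distrib_left sum_distrib_right sum.distrib[symmetric] distrib_left
        distrib_right mult_ac)
  also have "{..n} = insert 0 {1..n}"
    by auto
  finally show ?thesis
    by (simp add: linear_coeff_def algebra_simps)
qed

end

text \<open>
  The case \<open>n = 1\<close> is the equality \<open>q * f 1 = p * q = p * g 1\<close>. For larger \<open>n\<close> the difference
  \<open>p * g n - q * f n\<close> is a nonnegative combination of the differences \<open>g k - f k\<close> with
  \<open>k < n\<close>, where \<open>k = 0\<close> contributes zero. For \<open>k \<ge> 1\<close> these are positive by induction, since
  \<open>f k \<le> (p / q) * g k < g k\<close>.
\<close>

lemma recursion_comparison:
  fixes W :: "nat \<Rightarrow> nat \<Rightarrow> real" and f g :: "nat \<Rightarrow> real"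
  assumes pq: "0 < p" "p < q"
    and W: "\<And>n k. 0 \<le> W n k" "\<And>n. 1 \<le> n \<Longrightarrow> 0 < W n 0"
    and f: "f 0 = 1" "\<And>n. 1 \<le> n \<Longrightarrow> (\<Sum>k<n. W n k) * f n = p * (\<Sum>k<n. W n k * f k)"
    and g: "g 0 = 1" "\<And>n. 1 \<le> n \<Longrightarrow> (\<Sum>k<n. W n k) * g n = q * (\<Sum>k<n. W n k * g k)"
    and n: "1 \<le> n"
  shows "0 < g n \<and> q * f n \<le> p * g n \<and> (2 \<le> n \<longrightarrow> 0 < W n 1 \<longrightarrow> q * f n < p * g n)"
  using n
proof (induction n rule: less_induct)
  case (less n)
  have S: "0 < (\<Sum>k<n. W n k)"
    using W less.prems by (intro sum_pos2[of _ 0]) auto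
  have g_nonneg: "0 \<le> g k" if "k < n" for k
    using less.IH[of k] that g(1) by (cases "k = 0") auto
  have fg: "f k < g k" if "1 \<le> k" "k < n" for k
  proof -
    have "q * f k \<le> p * g k" "0 < g k"
      using less.IH[of k] that by auto
    moreover have "p * g k < q * g k"
      using pq \<open>0 < g k\<close> by simp
    ultimately have "q * f k < q * g k"
      by linarith
    then show ?thesis
      using pq by simp
  qed
  have fg': "f k \<le> g k" if "k < n" for k
    using fg[of k] that f(1) g(1) by (cases "k = 0") auto
  have "0 < (\<Sum>k<n. W n k * g k)"
    using W less.prems g(1) g_nonneg by (intro sum_pos2[of _ 0]) auto
  then have "0 < (\<Sum>k<n. W n k) * g n"
    using pq g(2)[OF less.prems] by simp
  then have "0 < g n"
    using S by (simp add: zero_less_mult_iff)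
  moreover have "(\<Sum>k<n. W n k) * (p * g n - q * f n) = p * q * ((\<Sum>k<n. W n k * g k) - (\<Sum>k<n. W n k * f k))"
    using f(2)[OF less.prems] g(2)[OF less.prems] by (simp add: right_diff_distrib mult.left_commute)
  then have diff: "(\<Sum>k<n. W n k) * (p * g n - q * f n) = p * q * (\<Sum>k<n. W n k * (g k - f k))"
    by (simp add: sum_subtractf right_diff_distrib)
  have "0 \<le> (\<Sum>k<n. W n k * (g k - f k))"
    using W fg' by (intro sum_nonneg) auto
  then have "0 \<le> (\<Sum>k<n. W n k) * (p * g n - q * f n)"
    unfolding diff using pq by simp
  then have "0 \<le> p * g n - q * f n"
    using S by (simp add: zero_le_mult_iff)
  moreover have "0 < p * g n - q * f n" if "2 \<le> n" "0 < W n 1"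
  proof -
    have "0 < (\<Sum>k<n. W n k * (g k - f k))"
      using W fg' that fg[of 1] by (intro sum_pos2[of _ 1]) auto
    then have "0 < (\<Sum>k<n. W n k) * (p * g n - q * f n)"
      unfolding diff using pq by simp
    then show ?thesis
      using S by (simp add: zero_less_mult_iff)
  qed
  ultimately show ?case
    by auto
qed

context first_piece_equation
begin

text \<open>
  The top coefficient is \<open>p E (1 - Z)\<^sup>n + (1 - p) (-1)\<^sup>n E Z\<^sup>n\<close>. It vanishes for \<open>n = 1\<close>, for
  \<open>p = 1 / 2\<close> and odd \<open>n\<close> by symmetry of \<open>Z\<close>, and for odd \<open>n\<close> if \<open>Y\<close> takes only the values 0
  and 1, because \<open>Z\<close> is then Bernoulli distributed. Once these cases are excluded, comparing the
  recursions for \<open>Z\<close> and \<open>1 - Z\<close> shows that \<open>p E (1 - Z)\<^sup>n\<close> and \<open>(1 - p) E Z\<^sup>n\<close> differ. So their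
  difference is nonzero, and so is their sum, since both are nonnegative.
\<close>

lemma top_coeff_nonzero:
  assumes "p \<noteq> 1 / 2" "2 \<le> n" "mixed_moment M 1 1 \<noteq> 0"
  shows "linear_coeff n n \<noteq> 0"
proof -
  let ?f = "\<lambda>k. mixed_moment L k 0" and ?g = "\<lambda>k. mixed_moment L 0 k"
  have W: "\<And>n k. 0 \<le> weight n k" "\<And>n. 1 \<le> n \<Longrightarrow> 0 < weight n 0" "0 < weight n 1"
    using weight_nonneg weight_0_pos weight_1_pos[OF assms(2,3)] by auto
  have neq: "p * ?g n \<noteq> (1 - p) * ?f n"
  proof (cases "p < 1 / 2")
    case True
    then have "(1 - p) * ?f n < p * ?g n"
      using recursion_comparison[of p "1 - p" weight ?f ?g n] p W assms(2)
        moment_recursion complement_moment_recursion by simp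
    then show ?thesis by simp
  next
    case False
    then have "p * ?g n < (1 - p) * ?f n"
      using recursion_comparison[of "1 - p" p weight ?g ?f n] p W assms(1,2)
        moment_recursion complement_moment_recursion by simp
    then show ?thesis by simp
  qed
  show ?thesis
  proof (cases "even n")
    case True
    have "0 \<le> ?f n" "0 \<le> ?g n"
      by (simp_all add: Z.mixed_moment_nonneg)
    with neq p have "0 < p * ?g n + (1 - p) * ?f n"
      by (smt (verit) mult_nonneg_nonneg)
    then show ?thesis
      using True by (simp add: linear_coeff_def)
  next
    case False
    then show ?thesis
      using neq by (simp add: linear_coeff_def left_diff_distrib)
  qed
qed

end

section \<open>Size-biasing and uniqueness\<close>

text \<open>
  The moments of positive order will be known only up to a common factor. This is enough to
  know the size-biased law, whose moments are ratios of moments of \<open>M\<close>.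
\<close>

definition size_biased :: "real measure \<Rightarrow> real measure" where
  "size_biased M = density M (\<lambda>x. ennreal (x / (\<integral>x. x \<partial>M)))"

context unit_interval_distribution
begin

context
  assumes nonzero: "AE x in M. x \<noteq> 0"
begin

lemma mean_pos: "0 < (\<integral>x. x \<partial>M)"
proof -
  have "AE x in M. 0 \<le> x"
    using AE_unit by eventually_elim simp
  moreover have "\<not> (AE x in M. x = 0)"
  proof
    assume "AE x in M. x = 0"
    with nonzero have "AE x in M. False"
      by eventually_elim simp
    then show False
      by simp
  qed
  ultimately have "(\<integral>x. x \<partial>M) \<noteq> 0" "0 \<le> (\<integral>x. x \<partial>M)"
    using integral_nonneg_eq_0_iff_AE[of M "\<lambda>x. x"] integrable_power_unit(1)[of 1]
    by (simp_all add: integral_nonneg_AE)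
  then show ?thesis
    by simp
qed

lemma size_biased_power: "(\<integral>x. x ^ n \<partial>size_biased M) = (\<integral>x. x ^ Suc n \<partial>M) / (\<integral>x. x \<partial>M)"
proof -
  have "AE x in M. 0 \<le> x / (\<integral>x. x \<partial>M)"
    using AE_unit by eventually_elim (use mean_pos in simp)
  then show ?thesis
    unfolding size_biased_def by (subst integral_real_density) simp_all
qed

lemma unit_interval_distribution_size_biased: "unit_interval_distribution (size_biased M)"
proof -
  have "AE x in M. 0 \<le> x / (\<integral>x. x \<partial>M)"
    using AE_unit by eventually_elim (use mean_pos in simp)
  then have "(\<integral>\<^sup>+x. ennreal (x / (\<integral>x. x \<partial>M)) \<partial>M) = ennreal (\<integral>x. x / (\<integral>x. x \<partial>M) \<partial>M)"
    using integrable_power_unit(1)[of 1] by (intro nn_integral_eq_integral) simp_all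
  then have "emeasure (size_biased M) (space (size_biased M)) = ennreal (\<integral>x. x / (\<integral>x. x \<partial>M) \<partial>M)"
    by (simp add: size_biased_def emeasure_density)
  also have "\<dots> = 1"
    using mean_pos by simp
  finally have "prob_space (size_biased M)"
    by (rule prob_spaceI)
  moreover have "AE x in size_biased M. x \<in> {0..1}"
    unfolding size_biased_def
    by (subst AE_density, simp, rule eventually_mono[OF AE_unit]) simp
  moreover have "sets (size_biased M) = sets borel"
    by (simp add: size_biased_def)
  ultimately show ?thesis
    by (intro unit_interval_distribution.intro real_distribution.intro
        real_distribution_axioms.intro unit_interval_distribution_axioms.intro)
qed

lemma density_size_biased: "density (size_biased M) (\<lambda>x. ennreal ((\<integral>x. x \<partial>M) / x)) = M"
proof -
  have "AE x in M. ennreal (x / (\<integral>x. x \<partial>M)) * ennreal ((\<integral>x. x \<partial>M) / x) = 1"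
    using AE_unit nonzero
  proof eventually_elim
    case (elim x)
    then show ?case
      using mean_pos by (simp flip: ennreal_mult)
  qed
  then have "density (size_biased M) (\<lambda>x. ennreal ((\<integral>x. x \<partial>M) / x)) = density M (\<lambda>_. 1)"
    unfolding size_biased_def by (subst density_density_eq) (auto intro!: density_cong)
  then show ?thesis
    by (simp add: density_1)
qed

end

end

text \<open>
  Both laws have a density proportional to \<open>1 / x\<close> with respect to the common size-biased law,
  so they are proportional; having the same total mass, they agree. An atom at 0 would be lost
  by size-biasing.
\<close>

lemma size_biased_inject:
  assumes M: "unit_interval_distribution M" "AE x in M. x \<noteq> 0"
    and N: "unit_interval_distribution N" "AE x in N. x \<noteq> 0"
    and eq: "size_biased M = size_biased N"
  shows "M = N"
proof -
  interpret M: unit_interval_distribution M by fact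
  interpret N: unit_interval_distribution N by fact
  define K where "K = size_biased M"
  interpret K: unit_interval_distribution K
    unfolding K_def by (rule M.unit_interval_distribution_size_biased) fact
  define a b where "a = (\<integral>x. x \<partial>M)" and "b = (\<integral>x. x \<partial>N)"
  have pos: "0 < a" "0 < b"
    unfolding a_def b_def using M.mean_pos[OF M(2)] N.mean_pos[OF N(2)] by auto
  have dens: "M = density K (\<lambda>x. ennreal (a / x))" "N = density K (\<lambda>x. ennreal (b / x))"
    using M.density_size_biased[OF M(2)] N.density_size_biased[OF N(2)]
    by (simp_all add: K_def a_def b_def eq)
  define I where "I = (\<integral>\<^sup>+x. ennreal (1 / x) \<partial>K)"
  have mass: "emeasure (density K (\<lambda>x. ennreal (c / x))) UNIV = ennreal c * I" if "0 < c" for c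
    using that unfolding I_def
    by (simp add: emeasure_density ennreal_mult'[symmetric] flip: nn_integral_cmult)
  have "ennreal a * I = 1" "ennreal b * I = 1"
    using mass[OF pos(1)] mass[OF pos(2)] M.emeasure_space_1 N.emeasure_space_1
    by (simp_all flip: dens)
  then have "ennreal a = ennreal b"
    by (metis mult.assoc mult.commute mult_1)
  then have "a = b"
    using pos by simp
  then show ?thesis
    using dens by simp
qed

text \<open>
  Each equation of order \<open>n \<ge> 2\<close> determines the \<open>n\<close>-th moment from the lower ones, so the
  solutions of the linear system form a line parametrized by the first moment. As the
  coefficients are common to \<open>M\<close> and \<open>N\<close>, it suffices that one of the two laws is nondegenerate.
\<close>

lemma proportional_moments:
  assumes "first_piece_equation p M L" "first_piece_equation p N L" "p \<noteq> 1 / 2"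
    and nondeg: "mixed_moment M 1 1 \<noteq> 0 \<or> mixed_moment N 1 1 \<noteq> 0"
    and "1 \<le> n"
  shows "mixed_moment M n 0 * mixed_moment N 1 0 = mixed_moment N n 0 * mixed_moment M 1 0"
  using \<open>1 \<le> n\<close>
proof (induction n rule: less_induct)
  case (less n)
  interpret M: first_piece_equation p M L by fact
  interpret N: first_piece_equation p N L by fact
  show ?case
  proof (cases "n = 1")
    case False
    then have n: "2 \<le> n"
      using less.prems by simp
    let ?d = "\<lambda>k. mixed_moment M k 0 * mixed_moment N 1 0 - mixed_moment N k 0 * mixed_moment M 1 0"
    have top: "M.linear_coeff n n \<noteq> 0"
      using nondeg M.top_coeff_nonzero[OF assms(3) n] N.top_coeff_nonzero[OF assms(3) n] by auto
    have "(\<Sum>k=1..n. M.linear_coeff n k * ?d k) =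
        (\<Sum>k=1..n. M.linear_coeff n k * mixed_moment M k 0) * mixed_moment N 1 0 -
        (\<Sum>k=1..n. M.linear_coeff n k * mixed_moment N k 0) * mixed_moment M 1 0"
      by (simp add: sum_distrib_right sum_subtractf right_diff_distrib mult.assoc)
    also have "\<dots> = 0"
      by (simp only: M.moments_linear_system N.moments_linear_system mult_zero_left diff_self)
    finally have "(\<Sum>k=1..n. M.linear_coeff n k * ?d k) = 0" .
    \<comment> \<open>By induction only the top term of this equation survives.\<close>
    moreover have "(\<Sum>k=1..n. M.linear_coeff n k * ?d k) = (\<Sum>k\<in>{n}. M.linear_coeff n k * ?d k)"
      using less by (intro sum.mono_neutral_right) auto
    ultimately show ?thesis
      using top by simp
  qed simp
qed

text \<open>
  If the linear system does not determine the moments up to scaling, then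
  \<open>E Y (1 - Y) = 0\<close> for both laws, and proportionality of the moments is immediate.
\<close>

lemma (in unit_interval_distribution) degenerate_moments:
  assumes "mixed_moment M 1 1 = 0" "1 \<le> n"
  shows "mixed_moment M n 0 = mixed_moment M 1 0"
proof -
  have "AE x in M. x * (1 - x) = 0"
    using assms(1) mixed_moment_eq_0_iff[of 1 1] by simp
  then have "AE x in M. x ^ n = x"
    by eventually_elim (use assms(2) in auto)
  then show ?thesis
    unfolding mixed_moment_def by (intro integral_cong_AE) auto
qed

theorem theorem1p1:
  fixes p :: real and \<mu> \<nu> :: "real measure"
  assumes "0 < p" "p < 1" "p \<noteq> 1 / 2"
    and "prob_space \<mu>" "sets \<mu> = sets borel" "measure \<mu> {0..1} = 1"
    and "prob_space \<nu>" "sets \<nu> = sets borel" "measure \<nu> {0..1} = 1"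
    and "measure \<mu> {0} = 0" "measure \<nu> {0} = 0"
    and "bernoulli_convolution p \<mu> = bernoulli_convolution p \<nu>"
  shows "\<mu> = \<nu>"
proof -
  let ?L = "bernoulli_convolution p \<mu>"
  have unit: "unit_interval_distribution M" and nz: "AE x in M. x \<noteq> 0"
    if "prob_space M" "sets M = sets borel" "measure M {0..1} = 1" "measure M {0} = 0" for M :: "real measure"
  proof -
    interpret prob_space M by fact
    have "AE x in M. x \<in> {0..1}"
      using that by (subst AE_in_set_eq_1) auto
    then show "unit_interval_distribution M"
      using that by (intro unit_interval_distribution.intro real_distribution.intro
          real_distribution_axioms.intro unit_interval_distribution_axioms.intro)
    show "AE x in M. x \<noteq> 0"
      using that by (intro AE_I[where N = "{0}"]) (auto simp: emeasure_eq_measure)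
  qed
  note \<mu> = unit[OF assms(4,5,6,10)] nz[OF assms(4,5,6,10)]
  note \<nu> = unit[OF assms(7,8,9,11)] nz[OF assms(7,8,9,11)]
  interpret \<mu>: unit_interval_distribution \<mu> by (rule \<mu>)
  interpret \<nu>: unit_interval_distribution \<nu> by (rule \<nu>)
  have fp: "first_piece_equation p M (bernoulli_convolution p M)"
    if "unit_interval_distribution M" "AE x in M. x \<noteq> 0" for M
    using that assms(1,2)
    by (intro first_piece_equation.intro first_piece_equation_axioms.intro
        unit_interval_distribution_bernoulli_convolution nn_integral_bernoulli_convolution_first_piece)
  have mom: "mixed_moment \<mu> n 0 * mixed_moment \<nu> 1 0 = mixed_moment \<nu> n 0 * mixed_moment \<mu> 1 0"
    if "1 \<le> n" for n
  proof (cases "mixed_moment \<mu> 1 1 \<noteq> 0 \<or> mixed_moment \<nu> 1 1 \<noteq> 0")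
    case True
    show ?thesis
      using fp[OF \<mu>] fp[OF \<nu>] assms(3) True that
      unfolding assms(12) by (rule proportional_moments)
  next
    case False
    then show ?thesis
      using \<mu>.degenerate_moments[OF _ that] \<nu>.degenerate_moments[OF _ that] by simp
  qed
  have "size_biased \<mu> = size_biased \<nu>"
  proof (rule unit_interval_distribution_eqI_moments)
    show "unit_interval_distribution (size_biased \<mu>)"
      by (rule \<mu>.unit_interval_distribution_size_biased \<mu>)+
    show "unit_interval_distribution (size_biased \<nu>)"
      by (rule \<nu>.unit_interval_distribution_size_biased \<nu>)+
    show "(\<integral>x. x ^ n \<partial>size_biased \<mu>) = (\<integral>x. x ^ n \<partial>size_biased \<nu>)" for n
      using mom[of "Suc n"] \<mu>.mean_pos[OF \<mu>(2)] \<nu>.mean_pos[OF \<nu>(2)]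
      by (simp add: \<mu>.size_biased_power[OF \<mu>(2)] \<nu>.size_biased_power[OF \<nu>(2)]
          mixed_moment_def frac_eq_eq)
  qed
  with \<mu> \<nu> show ?thesis
    by (rule size_biased_inject)
qed

end
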